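(* Let $A\in\mathbb{R}^{n\times n}$ be skew-symmetric ($A^{T}=-A$), let $B\in\mathbb{R}^{n\times n}$ be symmetric positive definite, and let $M=B^{1/2}$ be the symmetric positive definite square root of $B$. If $(\lambda,x)$ is an eigenpair of the matrix pair $(A,B)$, then $(\lambda,y)$ with $y:=Mx$ is an eigenpair of the skew-symmetric matrix $H=M^{-1}AM^{-1}$.
   Context: An eigenpair of the pair $(A,B)$ is a pair $(\lambda,x)$ with $\lambda\in\mathbb{C}$, $x\in\mathbb{C}^n$, $Ax=\lambda Bx$ and $\|x\|_B=1$, where $\|x\|_B=\sqrt{x^{H}Bx}$ ($x^H$ the conjugate transpose). An eigenpair of $H$ is a pair $(\lambda,y)$ with $Hy=\lambda y$, $y\neq 0$. *)

theory Defs
  imports "HOL-Analysis.Analysis"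
begin

definition skew_symmetric :: "real^'n^'n \<Rightarrow> bool" where
  "skew_symmetric A \<longleftrightarrow> transpose A = - A"

definition sym_pos_def :: "real^'n^'n \<Rightarrow> bool" where
  "sym_pos_def B \<longleftrightarrow> transpose B = B \<and> (\<forall>v. v \<noteq> 0 \<longrightarrow> v \<bullet> (B *v v) > 0)"

(* Well defined for symmetric positive definite B, see ex1_spd_sqrt below. *)
definition spd_sqrt :: "real^'n^'n \<Rightarrow> real^'n^'n" where
  "spd_sqrt B = (THE M. sym_pos_def M \<and> M ** M = B)"

abbreviation cmat :: "real^'n^'n \<Rightarrow> complex^'n^'n" where
  "cmat A \<equiv> map_matrix complex_of_real A"

(* The sum is x^H B x. For symmetric B it is a real number, so Re only adjusts the type. *)
definition norm_wrt :: "real^'n^'n \<Rightarrow> complex^'n \<Rightarrow> real" where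
  "norm_wrt B x = sqrt (Re (\<Sum>i\<in>UNIV. cnj (x $ i) * (cmat B *v x) $ i))"

definition pair_eigenpair :: "real^'n^'n \<Rightarrow> real^'n^'n \<Rightarrow> complex \<Rightarrow> complex^'n \<Rightarrow> bool" where
  "pair_eigenpair A B l x \<longleftrightarrow> cmat A *v x = l *s (cmat B *v x) \<and> norm_wrt B x = 1"

definition eigenpair :: "real^'n^'n \<Rightarrow> complex \<Rightarrow> complex^'n \<Rightarrow> bool" where
  "eigenpair H l y \<longleftrightarrow> cmat H *v y = l *s y \<and> y \<noteq> 0"

lemma sym_inner:
  fixes M :: "real^'n^'n"
  assumes "transpose M = M"
  shows "u \<bullet> (M *v v) = (M *v u) \<bullet> v"
  by (metis assms dot_lmul_matrix vector_transpose_matrix)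

lemma spd_sqrt_unique:
  fixes M N :: "real^'n^'n"
  assumes M: "sym_pos_def M" and N: "sym_pos_def N" and eq: "M ** M = N ** N"
  shows "M = N"
proof -
  define D where "D = M - N"
  have sM: "transpose M = M" and sN: "transpose N = N"
    using M N by (auto simp: sym_pos_def_def)
  have sD: "transpose D = D"
    using sM sN by (simp add: D_def transpose_def vec_eq_iff)
  have psdM: "v \<bullet> (M *v v) \<ge> 0" and psdN: "v \<bullet> (N *v v) \<ge> 0" for v
    using M N by (cases "v = 0"; force simp: sym_pos_def_def less_imp_le)+
  have tr: "trace (D ** P ** D) = (\<Sum>i\<in>UNIV. (D *v axis i 1) \<bullet> (P *v (D *v axis i 1)))"
    for P :: "real^'n^'n"
  proof -
    have "(Q :: real^'n^'n) $ i $ i = axis i 1 \<bullet> (Q *v axis i 1)" for Q i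
      by (simp add: inner_axis' matrix_vector_mult_basis column_def)
    then have "trace (D ** P ** D) = (\<Sum>i\<in>UNIV. axis i 1 \<bullet> ((D ** P ** D) *v axis i 1))"
      by (simp add: trace_def)
    also have "\<dots> = (\<Sum>i\<in>UNIV. (D *v axis i 1) \<bullet> (P *v (D *v axis i 1)))"
      by (simp add: sym_inner[OF sD] flip: matrix_vector_mul_assoc)
    finally show ?thesis .
  qed
  have "M ** M - N ** N = M ** D + D ** N"
    by (simp add: D_def vec_eq_iff matrix_matrix_mult_def algebra_simps sum_subtractf)
  then have z: "M ** D + D ** N = 0" using eq by simp
  have "trace (D ** M ** D) + trace (D ** N ** D) = trace (D ** (M ** D + D ** N))"
    by (metis matrix_add_ldistrib matrix_mul_assoc trace_add trace_mul_sym)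
  also have "\<dots> = 0" using z by (simp add: trace_def matrix_matrix_mult_def)
  finally have "trace (D ** M ** D) = 0"
    using psdM psdN
    by (smt (verit, best) sum_nonneg tr)
  then have "(D *v axis i 1) \<bullet> (M *v (D *v axis i 1)) = 0" for i
    unfolding tr using psdM by (subst (asm) sum_nonneg_eq_0_iff) auto
  then have "D *v axis i 1 = 0" for i
    using M by (metis less_irrefl sym_pos_def_def)
  then have "D = 0"
    by (simp add: vec_eq_iff matrix_vector_mult_basis column_def)
  then show ?thesis by (simp add: D_def)
qed

(* Existence: after rescaling, B / c = I - X with norm X < 1 and M = sqrt c (I - Y), where Y is
   the fixed point of the contraction Y |-> (X + Y^2) / 2. *)
lemma spd_sqrt_exists:
  fixes B :: "real^'n^'n"
  assumes B: "sym_pos_def B"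
  shows "\<exists>M. sym_pos_def M \<and> M ** M = B"
proof -
  have sB: "transpose B = B" using B by (simp add: sym_pos_def_def)
  let ?S = "sphere (0::real^'n) 1"
  have "?S \<noteq> {}" by simp
  moreover have "continuous_on ?S (\<lambda>v. v \<bullet> (B *v v))"
    by (intro continuous_intros matrix_vector_mult_linear_continuous_on)
  ultimately obtain v0 where v0: "v0 \<in> ?S" "\<And>v. v \<in> ?S \<Longrightarrow> v0 \<bullet> (B *v v0) \<le> v \<bullet> (B *v v)"
    using continuous_attains_inf[of ?S "\<lambda>v. v \<bullet> (B *v v)"] by (auto simp del: mem_sphere)
  define m where "m = v0 \<bullet> (B *v v0)"
  have "v0 \<noteq> 0" using v0(1) by auto
  then have m: "m > 0" using v0(1) B unfolding m_def sym_pos_def_def by fastforce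
  have low: "m * (norm v)\<^sup>2 \<le> v \<bullet> (B *v v)" for v
  proof (cases "v = 0")
    case False
    have "m \<le> sgn v \<bullet> (B *v sgn v)"
      unfolding m_def using False by (intro v0(2)) (simp add: norm_sgn)
    also have "\<dots> = (v \<bullet> (B *v v)) / (norm v)\<^sup>2"
      by (simp add: sgn_div_norm matrix_vector_mult_scaleR power2_eq_square divide_simps)
    finally show ?thesis using False by (simp add: field_simps)
  qed simp
  obtain K where K: "K > 0" "\<And>v. norm (B *v v) \<le> norm v * K"
    using bounded_linear.pos_bounded[OF matrix_vector_mul_bounded_linear[of B]] by blast
  define c where "c = K\<^sup>2 / m"
  have c: "c > 0" using K m by (simp add: c_def)
  define q where "q = sqrt (1 - (m / K)\<^sup>2)"
  have "m \<le> K"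
  proof -
    have "m * (norm v0)\<^sup>2 \<le> norm v0 * norm (B *v v0)"
      using low[of v0] norm_cauchy_schwarz[of v0 "B *v v0"] by linarith
    then show ?thesis using K(2)[of v0] v0(1) by simp
  qed
  then have q: "0 \<le> q" "q < 1" and q2: "q\<^sup>2 = 1 - (m / K)\<^sup>2"
    using m K(1) by (auto simp: q_def power_le_one)
  define X :: "(real^'n) \<Rightarrow>\<^sub>L (real^'n)" where "X = Blinfun (\<lambda>v. v - (1 / c) *\<^sub>R (B *v v))"
  have X: "blinfun_apply X v = v - (1 / c) *\<^sub>R (B *v v)" for v
    unfolding X_def
    by (subst bounded_linear_Blinfun_apply) (auto intro!: bounded_linear_intros matrix_vector_mul_bounded_linear)
  have nX: "norm X \<le> q"
  proof (rule norm_blinfun_bound[OF q(1)])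
    fix v
    have "(norm (X v))\<^sup>2 = (norm v)\<^sup>2 - 2 / c * (v \<bullet> (B *v v)) + (norm (B *v v))\<^sup>2 / c\<^sup>2"
      unfolding X power2_norm_eq_inner
      by (simp add: inner_diff_left inner_diff_right inner_commute power2_eq_square)
    also have "\<dots> \<le> (norm v)\<^sup>2 - 2 / c * (m * (norm v)\<^sup>2) + (norm v * K)\<^sup>2 / c\<^sup>2"
      using low[of v] K(2)[of v] c
      by (intro add_mono diff_mono mult_left_mono divide_right_mono power_mono) auto
    also have "\<dots> = (q * norm v)\<^sup>2"
      unfolding power_mult_distrib q2 c_def using m K(1)
      by (simp add: field_simps power2_eq_square)
    finally show "norm (X v) \<le> q * norm v"
      by (rule power2_le_imp_le) (use q in simp)
  qed
  define r where "r = 1 - sqrt (1 - q)"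
  have r: "0 \<le> r" "r < 1" and rq: "q + r\<^sup>2 = 2 * r"
    using q by (auto simp: r_def power2_diff)
  define S :: "((real^'n) \<Rightarrow>\<^sub>L (real^'n)) set"
    where "S = cball 0 r \<inter> (\<Inter>u. \<Inter>v. {Y. u \<bullet> blinfun_apply Y v = blinfun_apply Y u \<bullet> v})"
  define F where "F Y = (1/2) *\<^sub>R (X + (Y o\<^sub>L Y))" for Y
  have "closed S" unfolding S_def
    by (intro closed_Int closed_cball closed_INT ballI closed_Collect_eq continuous_intros)
  then have "complete S" by (simp add: complete_eq_closed)
  moreover have "S \<noteq> {}" proof -
    have "0 \<in> S" using r by (simp add: S_def)
    then show ?thesis by blast
  qed
  moreover have "F ` S \<subseteq> S"
  proof clarify
    fix Y assume Y: "Y \<in> S"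
    have n: "norm Y \<le> r" and s: "\<And>u v. u \<bullet> Y v = Y u \<bullet> v" using Y by (auto simp: S_def)
    have "norm (F Y) \<le> (1/2) * (norm X + norm (Y o\<^sub>L Y))"
      unfolding F_def by (simp add: norm_triangle_ineq)
    also have "\<dots> \<le> (1/2) * (q + r\<^sup>2)"
      using nX n norm_blinfun_compose[of Y Y] mult_mono[OF n n r(1)]
      by (simp add: power2_eq_square)
    finally have "norm (F Y) \<le> r" using rq by simp
    moreover have "u \<bullet> F Y v = F Y u \<bullet> v" for u v
      unfolding F_def
      by (simp add: blinfun.bilinear_simps X inner_add_left inner_add_right inner_diff_left
          inner_diff_right s sym_inner[OF sB])
    ultimately show "F Y \<in> S" by (simp add: S_def)
  qed
  moreover have "dist (F Y) (F Z) \<le> r * dist Y Z" if YZ: "Y \<in> S" "Z \<in> S" for Y Z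
  proof -
    have n: "norm Y \<le> r" "norm Z \<le> r" using YZ by (auto simp: S_def)
    have "F Y - F Z = (1/2) *\<^sub>R ((Y o\<^sub>L (Y - Z)) + ((Y - Z) o\<^sub>L Z))"
      by (rule blinfun_eqI) (simp add: F_def blinfun.bilinear_simps algebra_simps)
    then have "dist (F Y) (F Z) \<le> (1/2) * (norm (Y o\<^sub>L (Y - Z)) + norm ((Y - Z) o\<^sub>L Z))"
      by (simp add: dist_norm norm_triangle_ineq)
    also have "\<dots> \<le> (1/2) * (r * norm (Y - Z) + norm (Y - Z) * r)"
      using n r(1) by (intro mult_left_mono add_mono order.trans[OF norm_blinfun_compose] mult_mono) auto
    finally show ?thesis by (simp add: dist_norm)
  qed
  ultimately obtain Y where YS: "Y \<in> S" and FY: "F Y = Y"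
    using Banach_fix[of S r F] r by blast
  have nY: "norm Y \<le> r" and sY: "\<And>u v. u \<bullet> Y v = Y u \<bullet> v" using YS by (auto simp: S_def)
  have YY: "Y (Y v) = 2 *\<^sub>R Y v - X v" for v
  proof -
    have "2 *\<^sub>R Y v = 2 *\<^sub>R F Y v" using FY by simp
    also have "\<dots> = X v + Y (Y v)" by (simp add: F_def blinfun.bilinear_simps)
    finally show ?thesis by simp
  qed
  define M :: "real^'n^'n" where "M = matrix (\<lambda>v. sqrt c *\<^sub>R (v - Y v))"
  have lin: "Vector_Spaces.linear (*s) (*s) (\<lambda>v. sqrt c *\<^sub>R (v - Y v))"
    unfolding linear_matrix_vector_mul_eq
    by (rule linearI) (simp_all add: blinfun.bilinear_simps algebra_simps)
  have M: "M *v v = sqrt c *\<^sub>R (v - Y v)" for v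
    unfolding M_def by (rule matrix_works[OF lin])
  have "transpose M = M"
  proof -
    have "M $ i $ j = axis i 1 \<bullet> (M *v axis j 1)" for i j
      by (simp add: inner_axis' matrix_vector_mult_basis column_def)
    moreover have "u \<bullet> (M *v v) = v \<bullet> (M *v u)" for u v
      using sY[of u v] by (simp add: M inner_diff_right inner_commute[of u v] inner_commute[of v "Y u"])
    ultimately show ?thesis by (simp add: transpose_def vec_eq_iff)
  qed
  moreover have "v \<bullet> (M *v v) > 0" if "v \<noteq> 0" for v
  proof -
    have "v \<bullet> Y v \<le> norm v * norm (Y v)" by (rule norm_cauchy_schwarz)
    also have "\<dots> \<le> norm v * (r * norm v)"
      using nY by (intro mult_left_mono order.trans[OF norm_blinfun] mult_right_mono) auto
    also have "\<dots> < norm v * norm v" using that r(2) by simp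
    also have "\<dots> = v \<bullet> v" by (simp add: dot_square_norm power2_eq_square)
    finally show ?thesis using c by (simp add: M inner_diff_right)
  qed
  moreover have "M ** M = B"
  proof -
    have "(M ** M) *v v = B *v v" for v
    proof -
      have "(M ** M) *v v = (sqrt c * sqrt c) *\<^sub>R (v - Y v - (Y v - Y (Y v)))"
        by (simp add: M blinfun.bilinear_simps flip: matrix_vector_mul_assoc)
          (simp add: algebra_simps)
      also have "\<dots> = c *\<^sub>R (v - X v)" using c by (simp add: YY scaleR_2)
      also have "\<dots> = B *v v" using c by (simp add: X)
      finally show ?thesis .
    qed
    then show ?thesis by (simp add: matrix_eq)
  qed
  ultimately show ?thesis by (auto simp: sym_pos_def_def)
qed

lemma ex1_spd_sqrt:
  assumes "sym_pos_def B"
  shows "\<exists>!M. sym_pos_def M \<and> M ** M = B"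
  using spd_sqrt_exists[OF assms] spd_sqrt_unique by metis

end

theory Submission
  imports Defs
begin

text \<open>
  Substitute \<open>B = M ** M\<close> in \<open>A x = \<lambda> B x\<close> and multiply by \<open>M\<inverse>\<close> from the left: the
  result is \<open>M\<inverse> A x = \<lambda> M x\<close>, and \<open>M\<inverse> A x = H (M x)\<close> because \<open>x = M\<inverse> (M x)\<close>.  The vector
  \<open>M x\<close> is nonzero since \<open>M x = 0\<close> would give \<open>B x = M (M x) = 0\<close>, hence a vanishing \<open>B\<close>-norm of
  \<open>x\<close>.  Skew symmetry of \<open>H\<close> holds because \<open>M\<inverse>\<close> inherits symmetry from \<open>M\<close>
  (\<open>symmetric_matrix_inv\<close>), so that \<open>H\<close> is a congruence transform of \<open>A\<close>
  (\<open>skew_symmetric_congruence\<close>).  The matrices are real and the vectors complex, so the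
  matrix identities are carried over by the multiplicativity of \<open>cmat\<close> (\<open>cmat_mult\<close>).
\<close>

lemma cmat_mult: "cmat (P ** Q) = cmat P ** cmat Q"
  by (simp add: vec_eq_iff matrix_matrix_mult_def map_matrix_def)

lemma spd_sqrt_props:
  assumes "sym_pos_def B"
  shows "sym_pos_def (spd_sqrt B)" and "spd_sqrt B ** spd_sqrt B = B"
  using theI'[OF ex1_spd_sqrt[OF assms]] by (simp_all add: spd_sqrt_def)

text \<open>A kernel vector \<open>v\<close> has \<open>v \<bullet> M v = 0\<close>, so positivity makes the kernel trivial.\<close>

lemma sym_pos_def_invertible:
  assumes "sym_pos_def M"
  shows "invertible M"
proof -
  have "v = 0" if "M *v v = 0" for v
    using assms that by (metis inner_zero_right less_irrefl sym_pos_def_def)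
  then show ?thesis
    by (simp add: invertible_left_inverse matrix_left_invertible_ker)
qed

lemma matrix_inv_works:
  assumes "invertible M"
  shows matrix_inv_right: "M ** matrix_inv M = mat 1"
    and matrix_inv_left: "matrix_inv M ** M = mat 1"
  using someI_ex[OF assms[unfolded invertible_def]] by (simp_all add: matrix_inv_def)

text \<open>Transposing \<open>M ** M\<inverse> = 1\<close> exhibits the transpose of \<open>M\<inverse>\<close> as a left inverse of \<open>M\<close>, and
  a left inverse agrees with the right inverse \<open>M\<inverse>\<close>.\<close>

lemma symmetric_matrix_inv:
  fixes M :: "real^'n^'n"
  assumes "invertible M" and "transpose M = M"
  shows "transpose (matrix_inv M) = matrix_inv M"
proof -
  let ?N = "matrix_inv M"
  have "transpose ?N ** M = transpose (M ** ?N)"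
    by (simp add: matrix_transpose_mul assms(2))
  then have "transpose ?N ** M = mat 1"
    by (simp add: matrix_inv_right[OF assms(1)] transpose_mat)
  then have "transpose ?N ** (M ** ?N) = ?N"
    by (simp add: matrix_mul_assoc)
  then show ?thesis
    by (simp add: matrix_inv_right[OF assms(1)])
qed

lemma skew_symmetric_congruence:
  assumes "skew_symmetric A"
  shows "skew_symmetric (transpose N ** A ** N)"
proof -
  have "transpose N ** (- A) ** N = - (transpose N ** A ** N)"
    by (simp add: vec_eq_iff matrix_matrix_mult_def sum_negf)
  then show ?thesis
    using assms by (simp add: skew_symmetric_def matrix_transpose_mul matrix_mul_assoc)
qed

theorem theorem2p1:
  fixes A B M H :: "real^'n^'n"
  assumes "skew_symmetric A"
    and "sym_pos_def B"
    and "M = spd_sqrt B"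
    and "H = matrix_inv M ** A ** matrix_inv M"
  shows "skew_symmetric H \<and>
    (\<forall>l x. pair_eigenpair A B l x \<longrightarrow> eigenpair H l (cmat M *v x))"
proof (intro conjI allI impI)
  let ?N = "matrix_inv M"
  have M: "sym_pos_def M" and MM: "M ** M = B"
    using spd_sqrt_props[OF assms(2)] assms(3) by simp_all
  have inv: "invertible M"
    using M by (rule sym_pos_def_invertible)
  have "transpose ?N = ?N"
    using symmetric_matrix_inv[OF inv] M by (simp add: sym_pos_def_def)
  then show "skew_symmetric H"
    using skew_symmetric_congruence[OF assms(1), of ?N] assms(4) by simp
  fix l x
  assume "pair_eigenpair A B l x"
  then have eq: "cmat A *v x = l *s (cmat B *v x)" and nrm: "norm_wrt B x = 1"
    by (simp_all add: pair_eigenpair_def)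
  have HM: "H ** M = ?N ** A"
    by (simp add: assms(4) matrix_inv_left[OF inv] flip: matrix_mul_assoc)
  have NB: "?N ** B = M"
    by (simp add: MM[symmetric] matrix_mul_assoc matrix_inv_left[OF inv])
  have "cmat H *v (cmat M *v x) = cmat ?N *v (cmat A *v x)"
    by (simp add: matrix_vector_mul_assoc HM flip: cmat_mult)
  also have "\<dots> = l *s (cmat ?N *v (cmat B *v x))"
    by (simp add: eq vector_scalar_commute)
  also have "\<dots> = l *s (cmat M *v x)"
    by (simp add: matrix_vector_mul_assoc NB flip: cmat_mult)
  finally have "cmat H *v (cmat M *v x) = l *s (cmat M *v x)" .
  moreover have "cmat M *v x \<noteq> 0"
  proof
    assume "cmat M *v x = 0"
    then have "cmat B *v x = 0"
      by (simp add: MM[symmetric] cmat_mult flip: matrix_vector_mul_assoc)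
    then show False
      using nrm by (simp add: norm_wrt_def)
  qed
  ultimately show "eigenpair H l (cmat M *v x)"
    by (simp add: eigenpair_def)
qed

end
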